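(* Let $X$ be a locally compact Hausdorff space. Then the following are equivalent: (1) $X$ has a discretization; (2) $\mathrm{C}_{0}(X)$ has a (unique) closed essential ideal which is generated by its minimal projections.
   Context: A discretization of $X$ is a pair $(f,Y)$ where $Y$ is a discrete space and $f:Y\to X$ is a homeomorphic embedding with dense range. $\mathrm{C}_0(X)$ is the C$^*$-algebra of continuous complex-valued functions on $X$ vanishing at infinity, with the uniform norm and involution $f^*(x)=\overline{f(x)}$. A closed ideal $J$ of $\mathrm{C}_0(X)$ is essential if $J\cap K\neq\{0\}$ for every nonzero closed ideal $K$ of $\mathrm{C}_0(X)$. A projection is an element $p$ with $p=p^*=p^2$; projections are ordered by $p\le q$ iff $pq=p$ (i.e. inclusion of the sets of which $p,q$ are the characteristic functions). A minimal projection of an algebra is a nonzero projection in it which is minimal among its nonzero projections. A closed ideal $J$ is generated by its minimal projections if $J$ is the smallest C$^*$-subalgebra (uniformly closed, involution-closed subalgebra, not necessarily unital) of $\mathrm{C}_0(X)$ containing all minimal projections of $J$; the zero ideal is regarded as generated by its (empty set of) minimal projections. *)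

theory Defs
  imports "HOL-Analysis.Analysis"
begin

definition discretization :: "'a topology \<Rightarrow> 'b topology \<Rightarrow> ('b \<Rightarrow> 'a) \<Rightarrow> bool" where
  "discretization X Y f \<longleftrightarrow>
     Y = discrete_topology (topspace Y) \<and> embedding_map Y X f \<and>
     X closure_of (f ` topspace Y) = topspace X"

(* The discrete space is taken with points in the point type of X.  No generality is lost:
   see has_discretizationI, which accepts a discrete space over any type. *)
definition has_discretization :: "'a topology \<Rightarrow> bool" where
  "has_discretization X \<longleftrightarrow> (\<exists>(Y :: 'a topology) f. discretization X Y f)"

lemma has_discretizationI:
  fixes X :: "'a topology" and Y :: "'b topology"
  assumes "discretization X Y f"
  shows "has_discretization X"
proof -
  let ?Z = "subtopology X (f ` topspace Y)"
  have Y: "Y = discrete_topology (topspace Y)"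
    and hom: "homeomorphic_map Y ?Z f"
    and dense: "X closure_of (f ` topspace Y) = topspace X"
    using assms unfolding discretization_def embedding_map_def by blast+
  have top: "topspace ?Z = f ` topspace Y"
    by (rule homeomorphic_imp_surjective_map[OF hom, symmetric])
  have "openin ?Z {z}" if z: "z \<in> topspace ?Z" for z
  proof -
    obtain y where y: "y \<in> topspace Y" "z = f y" using z unfolding top by blast
    have "openin Y {y}" by (subst Y) (simp add: y(1))
    then have "openin ?Z (f ` {y})"
      using homeomorphic_imp_open_map[OF hom] unfolding open_map_def by blast
    then show ?thesis using y by simp
  qed
  then have disc: "?Z = discrete_topology (topspace ?Z)"
    by (metis discrete_topology_unique)
  have idim: "id ` S = S" for S :: "'a set"
    by simp
  have "embedding_map ?Z X id"
    unfolding embedding_map_def idim top by (rule homeomorphic_map_id[THEN iffD2, OF refl])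
  moreover have "X closure_of (id ` topspace ?Z) = topspace X"
    unfolding idim top by (rule dense)
  ultimately have "discretization X ?Z id"
    unfolding discretization_def using disc by (intro conjI)
  then show ?thesis unfolding has_discretization_def by blast
qed

(* Elements of C_0(X) are represented by total functions that are 0 outside the carrier
   of X, so that each has exactly one representative and the pointwise operations are
   those of C_0(X). *)
definition C0 :: "'a topology \<Rightarrow> ('a \<Rightarrow> complex) set" where
  "C0 X = {f. continuous_map X euclidean f \<and>
              (\<forall>\<epsilon>>0. compactin X {x \<in> topspace X. \<epsilon> \<le> cmod (f x)}) \<and>
              (\<forall>x. x \<notin> topspace X \<longrightarrow> f x = 0)}"

(* The inserted 0 gives the zero function norm 0 when X is empty. *)
definition unif_norm :: "'a topology \<Rightarrow> ('a \<Rightarrow> complex) \<Rightarrow> real" where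
  "unif_norm X f = Sup (insert 0 ((\<lambda>x. cmod (f x)) ` topspace X))"

definition unif_closed :: "'a topology \<Rightarrow> ('a \<Rightarrow> complex) set \<Rightarrow> bool" where
  "unif_closed X A \<longleftrightarrow>
     (\<forall>f\<in>C0 X. (\<forall>\<epsilon>>0. \<exists>g\<in>A. unif_norm X (\<lambda>x. f x - g x) < \<epsilon>) \<longrightarrow> f \<in> A)"

definition C0_subspace :: "'a topology \<Rightarrow> ('a \<Rightarrow> complex) set \<Rightarrow> bool" where
  "C0_subspace X A \<longleftrightarrow>
     A \<subseteq> C0 X \<and> (\<lambda>x. 0) \<in> A \<and>
     (\<forall>f\<in>A. \<forall>g\<in>A. (\<lambda>x. f x + g x) \<in> A) \<and>
     (\<forall>c. \<forall>f\<in>A. (\<lambda>x. c * f x) \<in> A)"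

definition closed_ideal :: "'a topology \<Rightarrow> ('a \<Rightarrow> complex) set \<Rightarrow> bool" where
  "closed_ideal X J \<longleftrightarrow>
     C0_subspace X J \<and> (\<forall>f\<in>C0 X. \<forall>g\<in>J. (\<lambda>x. f x * g x) \<in> J) \<and> unif_closed X J"

definition cstar_subalgebra :: "'a topology \<Rightarrow> ('a \<Rightarrow> complex) set \<Rightarrow> bool" where
  "cstar_subalgebra X A \<longleftrightarrow>
     C0_subspace X A \<and> (\<forall>f\<in>A. \<forall>g\<in>A. (\<lambda>x. f x * g x) \<in> A) \<and>
     (\<forall>f\<in>A. (\<lambda>x. cnj (f x)) \<in> A) \<and> unif_closed X A"

definition essential_closed_ideal :: "'a topology \<Rightarrow> ('a \<Rightarrow> complex) set \<Rightarrow> bool" where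
  "essential_closed_ideal X J \<longleftrightarrow>
     closed_ideal X J \<and>
     (\<forall>K. closed_ideal X K \<and> K \<noteq> {\<lambda>x. 0} \<longrightarrow> J \<inter> K \<noteq> {\<lambda>x. 0})"

definition is_projection :: "('a \<Rightarrow> complex) \<Rightarrow> bool" where
  "is_projection p \<longleftrightarrow> p = (\<lambda>x. cnj (p x)) \<and> p = (\<lambda>x. p x * p x)"

definition proj_le :: "('a \<Rightarrow> complex) \<Rightarrow> ('a \<Rightarrow> complex) \<Rightarrow> bool" where
  "proj_le p q \<longleftrightarrow> (\<lambda>x. p x * q x) = p"

definition minimal_projections :: "('a \<Rightarrow> complex) set \<Rightarrow> ('a \<Rightarrow> complex) set" where
  "minimal_projections A =
     {p \<in> A. is_projection p \<and> p \<noteq> (\<lambda>x. 0) \<and>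
        (\<forall>q\<in>A. is_projection q \<and> q \<noteq> (\<lambda>x. 0) \<and> proj_le q p \<longrightarrow> q = p)}"

definition generated_by_minimal_projections ::
    "'a topology \<Rightarrow> ('a \<Rightarrow> complex) set \<Rightarrow> bool" where
  "generated_by_minimal_projections X J \<longleftrightarrow>
     cstar_subalgebra X J \<and> minimal_projections J \<subseteq> J \<and>
     (\<forall>A. cstar_subalgebra X A \<and> minimal_projections J \<subseteq> A \<longrightarrow> J \<subseteq> A)"

end

(* X has a discretization iff its set D of isolated points is dense: if a discrete subspace E
   is dense and an open U meets E only in y, then U is contained in the closure of {y}, so
   {y} is open.  If D is dense, the ideal of functions vanishing off D is essential and
   generated by the indicators of isolated points, since a compact subset of D is finite.
   Conversely, in an ideal J generated by its minimal projections every function is constant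
   on the support of each minimal projection p.  As f p lies in J for every f in C_0(X), and
   C_0(X) separates points, the support of p is an isolated point, so J vanishes off D; and
   essentiality forces D to be dense and J to contain every indicator of an isolated point. *)
theory Submission
  imports Defs
begin

section \<open>Closure of C_0(X) under the pointwise operations\<close>

text \<open>The set where |h| is at least \<epsilon> is closed and lies in the union of two compact
  sets on which |f| or |g| is bounded below. This one criterion yields decay at infinity for sums,
  products, scalar multiples and conjugates.\<close>

lemma C0_dominated:
  assumes "f \<in> C0 X" "g \<in> C0 X" "continuous_map X euclidean h"
    and "\<And>x. x \<notin> topspace X \<Longrightarrow> h x = 0"
    and "0 < C" "\<And>x. x \<in> topspace X \<Longrightarrow> cmod (h x) \<le> C * (cmod (f x) + cmod (g x))"
  shows "h \<in> C0 X"
proof -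
  have "compactin X {x \<in> topspace X. \<epsilon> \<le> cmod (h x)}" if e: "\<epsilon> > 0" for \<epsilon>
  proof (rule closed_compactin)
    \<comment> \<open>If |f| and |g| are both below \<delta> at a point, then |h| is below 2 * C *
      \<delta> = \<epsilon> there.\<close>
    define \<delta> where "\<delta> = \<epsilon> / (2 * C)"
    have "\<delta> > 0" using e assms(5) by (simp add: \<delta>_def)
    then show "compactin X ({x \<in> topspace X. \<delta> \<le> cmod (f x)} \<union> {x \<in> topspace X. \<delta> \<le> cmod (g x)})"
      using assms(1,2) by (intro compactin_Un) (auto simp: C0_def)
    show "{x \<in> topspace X. \<epsilon> \<le> cmod (h x)} \<subseteq>
        {x \<in> topspace X. \<delta> \<le> cmod (f x)} \<union> {x \<in> topspace X. \<delta> \<le> cmod (g x)}"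
    proof (rule subsetI, rule ccontr)
      fix x assume x: "x \<in> {x \<in> topspace X. \<epsilon> \<le> cmod (h x)}"
        "x \<notin> {x \<in> topspace X. \<delta> \<le> cmod (f x)} \<union> {x \<in> topspace X. \<delta> \<le> cmod (g x)}"
      then have "cmod (f x) + cmod (g x) < 2 * \<delta>" by auto
      then have "C * (cmod (f x) + cmod (g x)) < C * (2 * \<delta>)" using assms(5) by simp
      also have "\<dots> = \<epsilon>" using assms(5) by (simp add: \<delta>_def)
      finally show False using assms(6)[of x] x(1) by auto
    qed
    have "continuous_map X euclidean (\<lambda>x. cmod (h x))"
      using assms(3) by (rule continuous_map_norm)
    then have "closedin X {x \<in> topspace X. cmod (h x) \<in> {\<epsilon>..}}"
      by (rule closedin_continuous_map_preimage) simp
    then show "closedin X {x \<in> topspace X. \<epsilon> \<le> cmod (h x)}" by simp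
  qed
  then show ?thesis using assms(3,4) by (simp add: C0_def)
qed

text \<open>On the compact set where |f| is at least 1 the image of f is compact, hence bounded;
  elsewhere 1 is a bound.\<close>

lemma C0_bounded:
  assumes "f \<in> C0 X"
  obtains C where "C > 0" "\<And>x. cmod (f x) \<le> C"
proof -
  let ?K = "{x \<in> topspace X. 1 \<le> cmod (f x)}"
  have "compactin X ?K" "continuous_map X euclidean f"
    using assms by (auto simp: C0_def)
  then have "compactin euclidean (f ` ?K)" by (rule image_compactin)
  then have "bounded (f ` ?K)" by (simp add: compact_imp_bounded)
  then obtain B where B: "\<And>x. x \<in> ?K \<Longrightarrow> cmod (f x) \<le> B"
    unfolding bounded_iff by blast
  have "cmod (f x) \<le> max 1 B" for x
  proof (cases "x \<in> ?K")
    case True then show ?thesis using B[of x] by simp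
  next
    case False then show ?thesis using assms by (cases "x \<in> topspace X") (auto simp: C0_def)
  qed
  then show ?thesis using that[of "max 1 B"] by simp
qed

lemma C0_zero: "(\<lambda>x. 0) \<in> C0 X"
  by (auto simp: C0_def)

lemma continuous_map_C0: "f \<in> C0 X \<Longrightarrow> continuous_map X euclidean f"
  by (simp add: C0_def)

lemma C0_eq_0: "f \<in> C0 X \<Longrightarrow> x \<notin> topspace X \<Longrightarrow> f x = 0"
  by (simp add: C0_def)

lemma C0_compose:
  assumes f: "f \<in> C0 X" and "continuous_on UNIV h" "h 0 = 0"
    and "C > 0" "\<And>z. cmod (h z) \<le> C * cmod z"
  shows "(\<lambda>x. h (f x)) \<in> C0 X"
proof (rule C0_dominated[OF f C0_zero])
  have "continuous_map X euclidean (h \<circ> f)"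
    using continuous_map_C0[OF f] assms(2) by (auto intro!: continuous_map_compose)
  then show "continuous_map X euclidean (\<lambda>x. h (f x))" by (simp add: o_def)
qed (use assms C0_eq_0[OF f] in auto)

lemma C0_cmult:
  assumes "f \<in> C0 X"
  shows "(\<lambda>x. c * f x) \<in> C0 X"
proof (rule C0_compose[OF assms])
  show "continuous_on UNIV ((*) c)" by (intro continuous_intros)
  \<comment> \<open>Adding 1 keeps the domination constant positive when c = 0.\<close>
  show "cmod c + 1 > 0" using norm_ge_zero[of c] by linarith
  show "cmod (c * z) \<le> (cmod c + 1) * cmod z" for z
    by (simp add: norm_mult algebra_simps)
qed simp

lemma C0_cnj:
  assumes "f \<in> C0 X"
  shows "(\<lambda>x. cnj (f x)) \<in> C0 X"
proof (rule C0_compose[OF assms, of cnj 1])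
  show "continuous_on UNIV cnj"
    using linear_continuous_on bounded_linear_cnj by blast
qed auto

lemma C0_add:
  assumes "f \<in> C0 X" "g \<in> C0 X"
  shows "(\<lambda>x. f x + g x) \<in> C0 X"
proof (rule C0_dominated[OF assms])
  show "continuous_map X euclidean (\<lambda>x. f x + g x)"
    using assms by (intro continuous_map_add continuous_map_C0)
  show "cmod (f x + g x) \<le> 1 * (cmod (f x) + cmod (g x))" for x
    by (simp add: norm_triangle_ineq)
qed (use assms[THEN C0_eq_0] in auto)

lemma C0_diff: "f \<in> C0 X \<Longrightarrow> g \<in> C0 X \<Longrightarrow> (\<lambda>x. f x - g x) \<in> C0 X"
  using C0_add[of f X "\<lambda>x. -1 * g x"] C0_cmult[of g X "-1"] by simp

text \<open>Since f is bounded, the product is dominated by a multiple of |g|; g fills both slots of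
  \<open>C0_dominated\<close>.\<close>

lemma C0_mult:
  assumes f: "f \<in> C0 X" and g: "g \<in> C0 X"
  shows "(\<lambda>x. f x * g x) \<in> C0 X"
proof -
  obtain C where C: "C > 0" "\<And>x. cmod (f x) \<le> C" using C0_bounded[OF f] by blast
  have "cmod (f x * g x) \<le> C * (cmod (g x) + cmod (g x))" for x
  proof -
    have "cmod (f x * g x) \<le> C * cmod (g x)"
      using C(2)[of x] by (simp add: norm_mult mult_right_mono)
    also have "\<dots> \<le> C * (cmod (g x) + cmod (g x))" using C(1) by simp
    finally show ?thesis .
  qed
  moreover have "continuous_map X euclidean (\<lambda>x. f x * g x)"
    using continuous_map_C0[OF f] continuous_map_C0[OF g]
    by (simp add: continuous_map_atin tendsto_mult)
  ultimately show ?thesis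
    using C0_eq_0[OF f] C(1) by (intro C0_dominated[OF g g]) auto
qed

section \<open>The uniform norm and uniform limits\<close>

lemma cmod_le_unif_norm:
  assumes "f \<in> C0 X"
  shows "cmod (f x) \<le> unif_norm X f"
proof -
  obtain C where C: "C > 0" "\<And>x. cmod (f x) \<le> C" using C0_bounded[OF assms] by blast
  then have "bdd_above (insert 0 ((\<lambda>x. cmod (f x)) ` topspace X))"
    unfolding bdd_above_def by (intro exI[of _ C]) auto
  then have "y \<le> unif_norm X f" if "y \<in> insert 0 ((\<lambda>x. cmod (f x)) ` topspace X)" for y
    unfolding unif_norm_def by (rule cSup_upper[OF that])
  then show ?thesis using assms by (cases "x \<in> topspace X") (auto simp: C0_def)
qed

lemma unif_norm_le:
  assumes "0 \<le> C" "\<And>x. x \<in> topspace X \<Longrightarrow> cmod (f x) \<le> C"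
  shows "unif_norm X f \<le> C"
  unfolding unif_norm_def using assms by (intro cSup_least) auto

text \<open>Evaluation at a point is contractive for the uniform norm, so an identity between two
  values survives uniform limits by an \<epsilon>/2 argument.\<close>

lemma unif_closed_eval_eq:
  assumes "A \<subseteq> C0 X" "f \<in> C0 X" "\<And>\<epsilon>. \<epsilon> > 0 \<Longrightarrow> \<exists>g\<in>A. unif_norm X (\<lambda>x. f x - g x) < \<epsilon>"
    and "\<And>g. g \<in> A \<Longrightarrow> g x = g y"
  shows "f x = f y"
proof -
  have "dist (f x) (f y) \<le> \<epsilon>" if e: "\<epsilon> > 0" for \<epsilon>
  proof -
    obtain g where g: "g \<in> A" "unif_norm X (\<lambda>x. f x - g x) < \<epsilon> / 2"
      using assms(3)[of "\<epsilon> / 2"] e by auto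
    then have *: "cmod (f z - g z) < \<epsilon> / 2" for z
      using cmod_le_unif_norm[OF C0_diff[of f X g], of z] assms(1,2) by fastforce
    have "f x - f y = (f x - g x) - (f y - g y)" using assms(4)[OF g(1)] by simp
    then have "dist (f x) (f y) \<le> cmod (f x - g x) + cmod (f y - g y)"
      by (metis dist_norm norm_triangle_ineq4)
    then show ?thesis using *[of x] *[of y] by linarith
  qed
  then show ?thesis by (meson dense_ge dist_le_zero_iff)
qed

section \<open>Ideals and subalgebras cut out by pointwise conditions\<close>

text \<open>One family serves three purposes: for the isolated points it is the ideal sought, for an
  open set it is the home of Urysohn functions, and for small open sets it supplies the ideals on
  which essentiality is tested.\<close>

definition vanishing_off :: "'a topology \<Rightarrow> 'a set \<Rightarrow> ('a \<Rightarrow> complex) set" where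
  "vanishing_off X S = {f \<in> C0 X. \<forall>x. x \<notin> S \<longrightarrow> f x = 0}"

lemma C0_subspace_vanishing_off: "C0_subspace X (vanishing_off X S)"
  unfolding C0_subspace_def vanishing_off_def
  by (auto intro: C0_zero C0_add C0_cmult)

lemma unif_closed_vanishing_off: "unif_closed X (vanishing_off X S)"
  unfolding unif_closed_def
proof (intro ballI impI)
  fix f assume f: "f \<in> C0 X" "\<forall>\<epsilon>>0. \<exists>g\<in>vanishing_off X S. unif_norm X (\<lambda>x. f x - g x) < \<epsilon>"
  have "f x = 0" if x: "x \<notin> S" for x
  proof -
    have "cmod (f x) \<le> \<epsilon>" if e: "\<epsilon> > 0" for \<epsilon>
    proof -
      obtain g where g: "g \<in> vanishing_off X S" "unif_norm X (\<lambda>x. f x - g x) < \<epsilon>"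
        using f(2) e by blast
      then show ?thesis
        using cmod_le_unif_norm[OF C0_diff[of f X g], of x] f(1) x by (auto simp: vanishing_off_def)
    qed
    then show ?thesis by (meson dense_ge norm_le_zero_iff)
  qed
  then show "f \<in> vanishing_off X S" using f(1) by (simp add: vanishing_off_def)
qed

lemma closed_ideal_vanishing_off: "closed_ideal X (vanishing_off X S)"
  unfolding closed_ideal_def
  using C0_subspace_vanishing_off unif_closed_vanishing_off
  by (auto simp: vanishing_off_def intro: C0_mult)

lemma cstar_subalgebra_vanishing_off: "cstar_subalgebra X (vanishing_off X S)"
  unfolding cstar_subalgebra_def
  by (intro conjI C0_subspace_vanishing_off unif_closed_vanishing_off)
    (simp_all add: vanishing_off_def C0_mult C0_cnj)

text \<open>A test algebra: once all minimal projections of J are constant on S, an ideal J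
  generated by them consists of functions constant on S.\<close>

lemma cstar_subalgebra_constant_on:
  "cstar_subalgebra X {f \<in> C0 X. f constant_on S}" (is "cstar_subalgebra X ?A")
proof -
  \<comment> \<open>The unary operations, scaling and conjugation, are obtained by letting F ignore
    its second argument.\<close>
  have op: "(\<lambda>x. F (f x) (g x)) constant_on S" if "f constant_on S" "g constant_on S"
    for f g and F :: "complex \<Rightarrow> complex \<Rightarrow> complex"
    using that unfolding constant_on_def by metis
  have "unif_closed X ?A"
    unfolding unif_closed_def
  proof (intro ballI impI)
    fix f assume f: "f \<in> C0 X" "\<forall>\<epsilon>>0. \<exists>g\<in>?A. unif_norm X (\<lambda>x. f x - g x) < \<epsilon>"
    have "f x = f y" if xy: "x \<in> S" "y \<in> S" for x y
    proof (rule unif_closed_eval_eq[of ?A X f])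
      show "g x = g y" if "g \<in> ?A" for g
        using that xy by (auto simp: constant_on_def)
    qed (use f in auto)
    then have "f constant_on S" unfolding constant_on_def by metis
    then show "f \<in> ?A" using f(1) by simp
  qed
  moreover have "(\<lambda>x. 0) constant_on S" by (auto simp: constant_on_def)
  moreover have "(\<lambda>x. c * f x) constant_on S" "(\<lambda>x. cnj (f x)) constant_on S"
    if "f constant_on S" for f c
    using op[OF that that, of "\<lambda>z w. c * z"] op[OF that that, of "\<lambda>z w. cnj z"] by auto
  ultimately show ?thesis
    unfolding cstar_subalgebra_def C0_subspace_def
    by (intro conjI ballI allI) (simp_all add: op C0_zero C0_add C0_cmult C0_mult C0_cnj)
qed

text \<open>Locally compact Hausdorff spaces are completely regular. Separating x from the
  complement of U \<inter> V, with U inside a compact K, confines the nonzero values to K and so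
  gives decay at infinity.\<close>

lemma C0_Urysohn:
  assumes "locally_compact_space X" "Hausdorff_space X" "openin X V" "x \<in> V"
  obtains f where "f \<in> vanishing_off X V" "f x = 1"
proof -
  have x: "x \<in> topspace X" using assms(3,4) openin_subset by blast
  then obtain U K where U: "openin X U" "compactin X K" "x \<in> U" "U \<subseteq> K"
    using assms(1) unfolding locally_compact_space_def by blast
  have "completely_regular_space X"
    using assms(1,2) locally_compact_regular_imp_completely_regular_space
      locally_compact_Hausdorff_imp_regular_space by blast
  moreover have "closedin X (topspace X - U \<inter> V)" "x \<in> topspace X - (topspace X - U \<inter> V)"
    using U assms x by auto
  ultimately obtain g :: "'a \<Rightarrow> real" where g: "continuous_map X (top_of_set {0..1}) g"
      "g x = 0" "g ` (topspace X - U \<inter> V) \<subseteq> {1}"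
    unfolding completely_regular_space_def by blast
  have gc: "continuous_map X euclidean g" using g(1) by (simp add: continuous_map_in_subtopology)
  \<comment> \<open>The separating function g is 0 at x and 1 off U \<inter> V, so it is reversed;
    the value 0 off the carrier is the convention of \<open>C0\<close>.\<close>
  define h where "h = (\<lambda>x. if x \<in> topspace X then complex_of_real (1 - g x) else 0)"
  have hc: "continuous_map X euclidean h"
  proof (rule continuous_map_eq)
    show "continuous_map X euclidean (\<lambda>x. complex_of_real (1 - g x))"
    proof -
      have "continuous_map X euclideanreal (\<lambda>x. 1 - g x)"
        using gc by (intro continuous_map_diff) auto
      moreover have "continuous_map euclideanreal euclidean complex_of_real"
        by (simp add: continuous_on_of_real_id)
      ultimately have "continuous_map X euclidean (complex_of_real \<circ> (\<lambda>x. 1 - g x))"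
        by (rule continuous_map_compose)
      then show ?thesis by (simp add: o_def)
    qed
  qed (simp add: h_def)
  have h0: "h y = 0" if "y \<notin> U \<inter> V" for y
    using g(3) that by (auto simp: h_def)
  have "compactin X {y \<in> topspace X. \<epsilon> \<le> cmod (h y)}" if "\<epsilon> > 0" for \<epsilon>
  proof (rule closed_compactin[OF U(2)])
    show "{y \<in> topspace X. \<epsilon> \<le> cmod (h y)} \<subseteq> K"
      using h0 U(4) that by force
    have "closedin X {y \<in> topspace X. cmod (h y) \<in> {\<epsilon>..}}"
      using continuous_map_norm[OF hc] by (rule closedin_continuous_map_preimage) simp
    then show "closedin X {y \<in> topspace X. \<epsilon> \<le> cmod (h y)}" by simp
  qed
  then have "h \<in> vanishing_off X V"
    using hc h0 by (auto simp: vanishing_off_def C0_def h_def)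
  moreover have "h x = 1" using x g(2) by (simp add: h_def)
  ultimately show ?thesis using that by blast
qed

section \<open>Isolated points and discretizations\<close>

definition isolated_points :: "'a topology \<Rightarrow> 'a set" where
  "isolated_points X = {x. openin X {x}}"

lemma has_discretization_iff_isolated_points_dense:
  assumes "t1_space X"
  shows "has_discretization X \<longleftrightarrow> X closure_of isolated_points X = topspace X"
proof
  assume "has_discretization X"
  then obtain Y :: "'a topology" and f where Y: "Y = discrete_topology (topspace Y)"
    and hom: "homeomorphic_map Y (subtopology X (f ` topspace Y)) f"
    and dense: "X closure_of (f ` topspace Y) = topspace X"
    unfolding has_discretization_def discretization_def embedding_map_def by blast
  have sub: "f ` topspace Y \<subseteq> topspace X"
    using homeomorphic_imp_surjective_map[OF hom] unfolding topspace_subtopology by blast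
  have "openin X {f y}" if y: "y \<in> topspace Y" for y
  proof -
    have "openin Y {y}" by (subst Y) (simp add: y)
    then have "openin (subtopology X (f ` topspace Y)) (f ` {y})"
      using homeomorphic_imp_open_map[OF hom] unfolding open_map_def by blast
    then obtain U where U: "openin X U" "{f y} = U \<inter> f ` topspace Y"
      unfolding openin_subtopology by auto
    \<comment> \<open>An open set lies in the closure of its trace on a dense set; here the trace is
      a single point, which is closed because X is T1.\<close>
    have "U \<subseteq> X closure_of (U \<inter> f ` topspace Y)"
      using openin_Int_closure_of_subset[OF U(1), of "f ` topspace Y"] dense
        openin_subset[OF U(1)] by auto
    also have "\<dots> = {f y}"
      unfolding U(2)[symmetric] using y sub assms
      by (intro closure_of_closedin) (auto simp: t1_space_closedin_singleton)
    finally have "U = {f y}" using U(2) by blast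
    then show ?thesis using U(1) by simp
  qed
  then have "f ` topspace Y \<subseteq> isolated_points X" by (auto simp: isolated_points_def)
  then show "X closure_of isolated_points X = topspace X"
    using dense closure_of_mono closure_of_subset_topspace by (metis subset_antisym)
next
  assume dense: "X closure_of isolated_points X = topspace X"
  \<comment> \<open>The isolated points, included by \<open>id\<close>, form the
    discretization.\<close>
  let ?Z = "subtopology X (isolated_points X)"
  have top: "topspace ?Z = isolated_points X"
    unfolding isolated_points_def using openin_subset by fastforce
  have "openin ?Z {z}" if "z \<in> isolated_points X" for z
    using that by (auto simp: isolated_points_def openin_subtopology)
  then have disc: "?Z = discrete_topology (topspace ?Z)"
    by (metis discrete_topology_unique top)
  have idim: "id ` S = S" for S :: "'a set"
    by simp
  have "embedding_map ?Z X id"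
    unfolding embedding_map_def idim top by (rule homeomorphic_map_id[THEN iffD2, OF refl])
  then have "discretization X ?Z id"
    using disc dense unfolding discretization_def idim top by blast
  then show "has_discretization X" by (rule has_discretizationI)
qed

section \<open>Indicators and projections\<close>

text \<open>A Urysohn function for the open set {d} is 1 at d and 0 elsewhere, so it is the
  indicator itself.\<close>

lemma indicator_isolated_in_vanishing_off:
  assumes "locally_compact_space X" "Hausdorff_space X" "openin X {d}" "d \<in> S"
  shows "indicator {d} \<in> vanishing_off X S"
proof -
  obtain f where f: "f \<in> vanishing_off X {d}" "f d = 1"
    using C0_Urysohn[OF assms(1-3)] by blast
  then have "f = indicator {d}" by (auto simp: vanishing_off_def indicator_def fun_eq_iff)
  then show ?thesis using f assms(4) unfolding vanishing_off_def by (auto simp: indicator_def)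
qed

text \<open>The equation z = z^2 has only the complex solutions 0 and 1, and both are real.\<close>

lemma is_projection_iff: "is_projection p \<longleftrightarrow> range p \<subseteq> {0, 1}"
proof
  assume "is_projection p"
  then have "p x = p x * p x" for x unfolding is_projection_def by metis
  then have "p x = 0 \<or> p x = 1" for x by (metis mult_cancel_right1)
  then show "range p \<subseteq> {0, 1}" by auto
next
  assume "range p \<subseteq> {0, 1}"
  then have "p x = 0 \<or> p x = 1" for x by auto
  then show "is_projection p" unfolding is_projection_def fun_eq_iff
    by (metis complex_cnj_one complex_cnj_zero mult_1 mult_zero_left)
qed

lemma indicator_minimal_projection:
  assumes "indicator {d} \<in> J"
  shows "indicator {d} \<in> minimal_projections J"
proof -
  have "q = indicator {d}"
    if q: "is_projection q" "q \<noteq> (\<lambda>x. 0)" "proj_le q (indicator {d})" for q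
  proof -
    have off: "q x = 0" if "x \<noteq> d" for x
      using fun_cong[OF q(3)[unfolded proj_le_def], of x] that by simp
    then have "q d \<noteq> 0" using q(2) by fastforce
    then have "q d = 1" using q(1) by (auto simp: is_projection_iff)
    then show ?thesis using off by (auto simp: indicator_def fun_eq_iff)
  qed
  moreover have "indicator {d} \<noteq> (\<lambda>x. 0 :: complex)"
    by (metis indicator_eq_0_iff singletonI)
  moreover have "is_projection (indicator {d})"
    by (auto simp: is_projection_iff indicator_def)
  ultimately show ?thesis using assms by (auto simp: minimal_projections_def)
qed

section \<open>Approximation by finite combinations of indicators\<close>

text \<open>The singletons of points of K form an open cover, and a finite subcover leaves finitely
  many points.\<close>

lemma compactin_isolated_points_finite:
  assumes "compactin X K" "K \<subseteq> isolated_points X"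
  shows "finite K"
proof -
  have "\<exists>F. finite F \<and> F \<subseteq> (\<lambda>x. {x}) ` K \<and> K \<subseteq> \<Union>F"
    using assms(2) by (intro compactinD[OF assms(1)]) (auto simp: isolated_points_def)
  then obtain F where F: "finite F" "F \<subseteq> (\<lambda>x. {x}) ` K" "K \<subseteq> \<Union>F" by blast
  then have "finite (\<Union>F)" by auto
  then show ?thesis using F(3) finite_subset by blast
qed

lemma C0_subspace_sum:
  assumes "C0_subspace X A" "finite F" "\<And>d. d \<in> F \<Longrightarrow> h d \<in> A"
  shows "(\<lambda>x. \<Sum>d\<in>F. c d * h d x) \<in> A"
  using assms(2,3)
proof (induction F rule: finite_induct)
  case empty
  then show ?case using assms(1) by (simp add: C0_subspace_def)
next
  case (insert d F)
  then have "(\<lambda>x. c d * h d x) \<in> A" "(\<lambda>x. \<Sum>d\<in>F. c d * h d x) \<in> A"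
    using assms(1) by (auto simp: C0_subspace_def)
  moreover have "(\<lambda>x. f x + g x) \<in> A" if "f \<in> A" "g \<in> A" for f g
    using assms(1) that by (simp add: C0_subspace_def)
  ultimately have "(\<lambda>x. c d * h d x + (\<Sum>d\<in>F. c d * h d x)) \<in> A"
    by blast
  then show ?case using insert.hyps by simp
qed

text \<open>Truncating f to the points where it is not small leaves a finite combination of
  indicators, since that set is compact and consists of isolated points. This gives both generation
  by minimal projections and the uniqueness of the ideal.\<close>

lemma vanishing_off_isolated_points_subset:
  assumes A: "C0_subspace X A" "unif_closed X A"
    and ind: "\<And>d. d \<in> isolated_points X \<Longrightarrow> indicator {d} \<in> A"
  shows "vanishing_off X (isolated_points X) \<subseteq> A"
proof
  fix f assume f: "f \<in> vanishing_off X (isolated_points X)"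
  have "\<exists>g\<in>A. unif_norm X (\<lambda>x. f x - g x) < \<epsilon>" if e: "\<epsilon> > 0" for \<epsilon>
  proof -
    \<comment> \<open>The cutoff \<epsilon>/2 leaves an error of at most \<epsilon>/2, hence
      strictly below \<epsilon>.\<close>
    define K where "K = {x \<in> topspace X. \<epsilon> / 2 \<le> cmod (f x)}"
    have "\<epsilon> / 2 > 0" using e by simp
    then have "compactin X K" using f unfolding K_def vanishing_off_def C0_def by blast
    moreover have K: "K \<subseteq> isolated_points X" using f e by (force simp: K_def vanishing_off_def)
    ultimately have fin: "finite K" by (rule compactin_isolated_points_finite)
    define g where "g = (\<lambda>x. \<Sum>d\<in>K. f d * indicator {d} x)"
    have "g \<in> A" unfolding g_def using A(1) fin ind K by (intro C0_subspace_sum) auto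
    moreover have "g x = (if x \<in> K then f x else 0)" for x
      using fin by (simp add: g_def indicator_def sum.delta' cong: if_cong)
    then have "unif_norm X (\<lambda>x. f x - g x) \<le> \<epsilon> / 2"
      using e by (intro unif_norm_le) (auto simp: K_def)
    ultimately show ?thesis using e by (intro bexI[of _ g]) auto
  qed
  then show "f \<in> A" using A(2) f by (auto simp: unif_closed_def vanishing_off_def)
qed

section \<open>Supports of minimal projections\<close>

text \<open>The product of p and q is a projection in J below both, and it is nonzero at x;
  minimality identifies it with each of them.\<close>

lemma minimal_projection_unique_if_not_orthogonal:
  assumes J: "\<And>f g. f \<in> J \<Longrightarrow> g \<in> J \<Longrightarrow> (\<lambda>x. f x * g x) \<in> J"
    and p: "p \<in> minimal_projections J" and q: "q \<in> minimal_projections J"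
    and x: "p x \<noteq> 0" "q x \<noteq> 0"
  shows "p = q"
proof -
  let ?r = "\<lambda>x. p x * q x"
  have pr: "is_projection p" "is_projection q" "p \<in> J" "q \<in> J"
    using p q by (auto simp: minimal_projections_def)
  have "?r x \<in> {0, 1} \<and> ?r x * p x = ?r x \<and> ?r x * q x = ?r x" for x
  proof -
    have "p x \<in> {0, 1}" "q x \<in> {0, 1}" using pr(1,2) by (auto simp: is_projection_iff)
    then show ?thesis by auto
  qed
  then have "is_projection ?r" "proj_le ?r p" "proj_le ?r q"
    unfolding is_projection_iff proj_le_def fun_eq_iff by blast+
  moreover have "?r \<noteq> (\<lambda>x. 0)" using x by (metis mult_eq_0_iff)
  moreover have "?r \<in> J" by (rule J[OF pr(3,4)])
  ultimately have "?r = p" "?r = q" using p q unfolding minimal_projections_def by blast+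
  then show ?thesis by simp
qed

lemma minimal_projection_support_isolated:
  assumes "locally_compact_space X" "Hausdorff_space X"
    and J: "closed_ideal X J" "generated_by_minimal_projections X J"
    and p: "p \<in> minimal_projections J" and d: "p d \<noteq> 0"
  shows "d \<in> isolated_points X"
proof -
  let ?S = "{x. p x \<noteq> 0}"
  have sub: "J \<subseteq> C0 X"
    using J(1) by (simp add: closed_ideal_def C0_subspace_def)
  have mult: "(\<lambda>x. f x * g x) \<in> J" if "f \<in> C0 X" "g \<in> J" for f g
    using J(1) that by (simp add: closed_ideal_def)
  have pp: "p \<in> J" "is_projection p" using p by (auto simp: minimal_projections_def)
  \<comment> \<open>A minimal projection q either meets the support of p, and then equals p and is 1
    there, or vanishes on that support.\<close>
  have "minimal_projections J \<subseteq> {f \<in> C0 X. f constant_on ?S}"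
  proof
    fix q assume q: "q \<in> minimal_projections J"
    have "q constant_on ?S"
    proof (cases "\<exists>x\<in>?S. q x \<noteq> 0")
      case True
      then have "p = q"
        using minimal_projection_unique_if_not_orthogonal[OF _ p q] mult sub by blast
      then show ?thesis using pp(2)
        unfolding constant_on_def is_projection_iff by (intro exI[of _ 1]) auto
    next
      case False then show ?thesis unfolding constant_on_def by (intro exI[of _ 0]) auto
    qed
    then show "q \<in> {f \<in> C0 X. f constant_on ?S}"
      using q sub by (auto simp: minimal_projections_def)
  qed
  then have const: "J \<subseteq> {f \<in> C0 X. f constant_on ?S}"
    using J(2) cstar_subalgebra_constant_on[of X ?S]
    unfolding generated_by_minimal_projections_def by blast
  have top: "?S \<subseteq> topspace X" using pp(1) sub by (auto simp: C0_def)
  have "y = d" if y: "p y \<noteq> 0" for y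
  proof (rule ccontr)
    assume "y \<noteq> d"
    \<comment> \<open>A second support point y is excluded by an f with f d = 1 and f y = 0: the
      product f p lies in J but takes different values at d and y.\<close>
    have "openin X (topspace X - {y})"
      using assms(2) y top by (intro openin_diff) (auto simp: closedin_Hausdorff_sing_eq)
    moreover have "d \<in> topspace X - {y}" using d top \<open>y \<noteq> d\<close> by auto
    ultimately obtain f where f: "f \<in> vanishing_off X (topspace X - {y})" "f d = 1"
      using C0_Urysohn[OF assms(1,2)] by blast
    have "(\<lambda>x. f x * p x) \<in> J" using f(1) pp(1) by (intro mult) (auto simp: vanishing_off_def)
    then have "(\<lambda>x. f x * p x) constant_on ?S" using const by blast
    then obtain c where "\<And>x. p x \<noteq> 0 \<Longrightarrow> f x * p x = c"
      unfolding constant_on_def by auto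
    then have "f y * p y = f d * p d" using y d by metis
    moreover have "f y = 0" using f(1) by (simp add: vanishing_off_def)
    ultimately show False using f(2) d by simp
  qed
  \<comment> \<open>The support is the preimage of the open set of nonzero numbers, so its being {d}
    makes d isolated.\<close>
  then have S: "{x \<in> topspace X. p x \<in> - {0}} = {d}" using d top by blast
  have "openin X {x \<in> topspace X. p x \<in> - {0}}"
    using pp(1) sub by (intro openin_continuous_map_preimage[of X euclidean]) (auto simp: C0_def)
  then show ?thesis unfolding S isolated_points_def by simp
qed

section \<open>The essential ideal and its uniqueness\<close>

text \<open>For a nonzero g in K, density gives an isolated point d with g d nonzero. Multiplying g
  by the indicator of {d} then gives a nonzero element of both ideals.\<close>

lemma vanishing_off_isolated_points_essential:
  assumes "locally_compact_space X" "Hausdorff_space X"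
    and dense: "X closure_of isolated_points X = topspace X"
  shows "essential_closed_ideal X (vanishing_off X (isolated_points X))"
  unfolding essential_closed_ideal_def
proof (intro conjI allI impI closed_ideal_vanishing_off)
  fix K assume K: "closed_ideal X K \<and> K \<noteq> {\<lambda>x. 0}"
  then have K': "(\<lambda>x. 0) \<in> K" "K \<subseteq> C0 X" by (auto simp: closed_ideal_def C0_subspace_def)
  then obtain g where g: "g \<in> K" "g \<noteq> (\<lambda>x. 0)" using K by blast
  have gC: "g \<in> C0 X" using g K' by blast
  obtain x where x: "g x \<noteq> 0" using g(2) by blast
  let ?U = "{x \<in> topspace X. g x \<in> - {0}}"
  have "openin X ?U"
    using gC by (intro openin_continuous_map_preimage[of X euclidean]) (auto simp: C0_def)
  moreover have "x \<in> ?U" using x gC by (auto simp: C0_def)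
  moreover have "x \<in> X closure_of isolated_points X"
    unfolding dense using x gC by (auto simp: C0_def)
  ultimately obtain d where "d \<in> isolated_points X" "d \<in> ?U"
    unfolding in_closure_of by meson
  then have d: "d \<in> isolated_points X" "g d \<noteq> 0" by auto
  have ind: "indicator {d} \<in> vanishing_off X (isolated_points X)"
    using d by (intro indicator_isolated_in_vanishing_off assms) (auto simp: isolated_points_def)
  let ?h = "\<lambda>x. indicator {d} x * g x"
  have "?h \<in> K" using K ind g(1) by (auto simp: closed_ideal_def vanishing_off_def)
  moreover have "?h \<in> vanishing_off X (isolated_points X)"
    using ind gC by (auto simp: vanishing_off_def intro: C0_mult)
  moreover have "?h d \<noteq> 0" using d by simp
  then have "?h \<noteq> (\<lambda>x. 0)" by metis
  ultimately show "vanishing_off X (isolated_points X) \<inter> K \<noteq> {\<lambda>x. 0}" by blast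
qed

text \<open>The indicators of isolated points are minimal projections, and their finite combinations
  are uniformly dense in this ideal.\<close>

lemma vanishing_off_isolated_points_generated:
  assumes "locally_compact_space X" "Hausdorff_space X"
  shows "generated_by_minimal_projections X (vanishing_off X (isolated_points X))"
  unfolding generated_by_minimal_projections_def
proof (intro conjI allI impI cstar_subalgebra_vanishing_off)
  fix A
  assume A: "cstar_subalgebra X A \<and>
      minimal_projections (vanishing_off X (isolated_points X)) \<subseteq> A"
  have "indicator {d} \<in> A" if d: "d \<in> isolated_points X" for d
  proof -
    have "indicator {d} \<in> vanishing_off X (isolated_points X)"
      using d by (intro indicator_isolated_in_vanishing_off assms) (auto simp: isolated_points_def)
    then have "indicator {d} \<in> minimal_projections (vanishing_off X (isolated_points X))"
      by (rule indicator_minimal_projection)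
    then show ?thesis using conjunct2[OF A] by (rule rev_subsetD)
  qed
  then show "vanishing_off X (isolated_points X) \<subseteq> A"
    using A by (intro vanishing_off_isolated_points_subset) (auto simp: cstar_subalgebra_def)
qed (auto simp: minimal_projections_def)

lemma essential_generated_by_minimal_projections:
  assumes X: "locally_compact_space X" "Hausdorff_space X"
    and J: "essential_closed_ideal X J" "generated_by_minimal_projections X J"
  shows "J = vanishing_off X (isolated_points X)"
    and "X closure_of isolated_points X = topspace X"
proof -
  have id: "closed_ideal X J" using J(1) by (simp add: essential_closed_ideal_def)
  then have sub: "C0_subspace X J" "J \<subseteq> C0 X"
    by (auto simp: closed_ideal_def C0_subspace_def)
  \<comment> \<open>Essentiality is used only against the ideals \<open>vanishing_off X V\<close>
    with V open and nonempty, which are nonzero by Urysohn functions.\<close>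
  have ess: "\<exists>g\<in>J. g \<in> vanishing_off X V \<and> g \<noteq> (\<lambda>x. 0)" if V: "openin X V" "V \<noteq> {}" for V
  proof -
    obtain x where "x \<in> V" using V(2) by blast
    then obtain f where f: "f \<in> vanishing_off X V" "f x = 1"
      using C0_Urysohn[OF X V(1)] by blast
    then have "f \<noteq> (\<lambda>x. 0)" by auto
    then have "vanishing_off X V \<noteq> {\<lambda>x. 0}" using f(1) by blast
    then have "J \<inter> vanishing_off X V \<noteq> {\<lambda>x. 0}"
      using J(1) closed_ideal_vanishing_off unfolding essential_closed_ideal_def by blast
    moreover have "(\<lambda>x. 0) \<in> J \<inter> vanishing_off X V"
      using sub(1) C0_subspace_vanishing_off[of X V] by (simp add: C0_subspace_def)
    ultimately show ?thesis by blast
  qed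
  have "minimal_projections J \<subseteq> vanishing_off X (isolated_points X)"
    using minimal_projection_support_isolated[OF X id J(2)] sub(2)
    by (auto simp: vanishing_off_def minimal_projections_def)
  then have le: "J \<subseteq> vanishing_off X (isolated_points X)"
    using J(2) cstar_subalgebra_vanishing_off
    unfolding generated_by_minimal_projections_def by blast
  \<comment> \<open>Functions vanishing off {d} are multiples of its indicator, so the nonzero one
    supplied by \<open>ess\<close> can be rescaled.\<close>
  have "indicator {d} \<in> J" if d: "d \<in> isolated_points X" for d
  proof -
    obtain g where g: "g \<in> J" "g \<in> vanishing_off X {d}" "g \<noteq> (\<lambda>x. 0)"
      using ess[of "{d}"] d by (auto simp: isolated_points_def)
    then have off: "g x = 0" if "x \<noteq> d" for x using that by (simp add: vanishing_off_def)
    then have "g d \<noteq> 0" using g(3) by fastforce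
    then have "(\<lambda>x. inverse (g d) * g x) = indicator {d}"
      using off by (auto simp: indicator_def fun_eq_iff)
    moreover have "(\<lambda>x. inverse (g d) * g x) \<in> J"
      using sub(1) g(1) by (simp add: C0_subspace_def)
    ultimately show ?thesis by simp
  qed
  then show "J = vanishing_off X (isolated_points X)"
    using le vanishing_off_isolated_points_subset[OF sub(1)] id
    by (auto simp: closed_ideal_def)
  show "X closure_of isolated_points X = topspace X"
  proof (rule ccontr)
    assume n: "X closure_of isolated_points X \<noteq> topspace X"
    \<comment> \<open>A function in J supported in ?V must vanish on ?V, which contains no isolated
      point, and also off ?V; so it is zero, contradicting \<open>ess\<close>.\<close>
    let ?V = "topspace X - X closure_of isolated_points X"
    have "?V \<noteq> {}" using n closure_of_subset_topspace by fastforce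
    moreover have "openin X ?V" by auto
    ultimately obtain g where g: "g \<in> J" "g \<in> vanishing_off X ?V" "g \<noteq> (\<lambda>x. 0)"
      using ess by blast
    have "isolated_points X \<subseteq> X closure_of isolated_points X"
      using openin_subset by (intro closure_of_subset) (fastforce simp: isolated_points_def)
    then have "g x = 0" for x using g(1,2) le by (auto simp: vanishing_off_def)
    then show False using g(3) by blast
  qed
qed

theorem corollary7p6:
  fixes X :: "'a topology"
  assumes "locally_compact_space X" and "Hausdorff_space X"
  shows "(has_discretization X \<longleftrightarrow>
            (\<exists>J. essential_closed_ideal X J \<and> generated_by_minimal_projections X J)) \<and>
         (has_discretization X \<longleftrightarrow>
            (\<exists>!J. essential_closed_ideal X J \<and> generated_by_minimal_projections X J))"
proof -
  have "has_discretization X \<longleftrightarrow> X closure_of isolated_points X = topspace X"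
    using has_discretization_iff_isolated_points_dense Hausdorff_imp_t1_space assms(2) by blast
  \<comment> \<open>Every admissible J is the same ideal determined by X, so existence already
    yields unique existence.\<close>
  then show ?thesis
    using vanishing_off_isolated_points_essential[OF assms]
      vanishing_off_isolated_points_generated[OF assms]
      essential_generated_by_minimal_projections[OF assms] by metis
qed

end
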